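(* Let $A$ be a commutative ring with nonzero identity, let $M$ be an $A$-module and $P$ a proper submodule of $M$. Then $P$ is a classical 1-absorbing prime submodule of $M$ if and only if $S=M\setminus P$ is a classical 1-absorbing prime m-closed set.
   Context: All rings are commutative with nonzero identity; the given module $M$ is nonzero and unital. A proper submodule $P$ of an $A$-module $M$ is a classical 1-absorbing prime submodule if whenever $abcm\in P$ for nonunits $a,b,c\in A$ and $m\in M$, then $abm\in P$ or $cm\in P$. A subset $S$ of $M\setminus\{0\}$ is a classical 1-absorbing prime m-closed set if for all proper ideals $I,J,K$ of $A$ and all submodules $L,N$ of $M$, $(N+IJL)\cap S\neq\emptyset$ and $(N+KL)\cap S\neq\emptyset$ imply $(N+IJKL)\cap S\neq\emptyset$. *)

theory Defs
  imports "HOL-Algebra.Algebra"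
begin

text \<open>The product of an ideal and a submodule: all finite sums of products \<open>i \<odot> n\<close>,
  in the style of \<^const>\<open>ideal_prod\<close>. No separate clauses for zero and negatives are needed
  when \<open>I\<close> is an ideal and \<open>N\<close> a submodule.\<close>

inductive_set
  ideal_smult :: "('r, 'm, 'c) module_scheme \<Rightarrow> 'r set \<Rightarrow> 'm set \<Rightarrow> 'm set"
  for M (structure) and I and N where
    prod: "\<lbrakk> i \<in> I; n \<in> N \<rbrakk> \<Longrightarrow> i \<odot> n \<in> ideal_smult M I N"
  | sum: "\<lbrakk> x \<in> ideal_smult M I N; y \<in> ideal_smult M I N \<rbrakk> \<Longrightarrow> x \<oplus> y \<in> ideal_smult M I N"

definition proper_ideal :: "'r set \<Rightarrow> ('r, 'b) ring_scheme \<Rightarrow> bool" where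
  "proper_ideal I A \<longleftrightarrow> ideal I A \<and> I \<noteq> carrier A"

definition proper_submodule ::
  "'m set \<Rightarrow> ('r, 'b) ring_scheme \<Rightarrow> ('r, 'm, 'c) module_scheme \<Rightarrow> bool" where
  "proper_submodule P A M \<longleftrightarrow> submodule P A M \<and> P \<noteq> carrier M"

definition nonunits :: "('r, 'b) ring_scheme \<Rightarrow> 'r set" where
  "nonunits A = carrier A - Units A"

definition classical_1_absorbing_prime ::
  "'m set \<Rightarrow> ('r, 'b) ring_scheme \<Rightarrow> ('r, 'm, 'c) module_scheme \<Rightarrow> bool" where
  "classical_1_absorbing_prime P A M \<longleftrightarrow>
     proper_submodule P A M \<and>
     (\<forall>a \<in> nonunits A. \<forall>b \<in> nonunits A. \<forall>c \<in> nonunits A. \<forall>m \<in> carrier M.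
        (a \<otimes>\<^bsub>A\<^esub> b \<otimes>\<^bsub>A\<^esub> c) \<odot>\<^bsub>M\<^esub> m \<in> P \<longrightarrow>
          (a \<otimes>\<^bsub>A\<^esub> b) \<odot>\<^bsub>M\<^esub> m \<in> P \<or> c \<odot>\<^bsub>M\<^esub> m \<in> P)"

definition classical_1_absorbing_prime_m_closed ::
  "'m set \<Rightarrow> ('r, 'b) ring_scheme \<Rightarrow> ('r, 'm, 'c) module_scheme \<Rightarrow> bool" where
  "classical_1_absorbing_prime_m_closed S A M \<longleftrightarrow>
     S \<subseteq> carrier M - {\<zero>\<^bsub>M\<^esub>} \<and>
     (\<forall>I J K L N.
        proper_ideal I A \<and> proper_ideal J A \<and> proper_ideal K A \<and>
        submodule L A M \<and> submodule N A M \<longrightarrow>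
        (N <+>\<^bsub>M\<^esub> ideal_smult M (I \<cdot>\<^bsub>A\<^esub> J) L) \<inter> S \<noteq> {} \<longrightarrow>
        (N <+>\<^bsub>M\<^esub> ideal_smult M K L) \<inter> S \<noteq> {} \<longrightarrow>
        (N <+>\<^bsub>M\<^esub> ideal_smult M (I \<cdot>\<^bsub>A\<^esub> J \<cdot>\<^bsub>A\<^esub> K) L) \<inter> S \<noteq> {})"

end

theory Submission
  imports Defs
begin

text \<open>
  For a submodule \<open>N\<close> and a set \<open>T\<close> containing zero, \<open>N + T\<close> meets the complement of \<open>P\<close> exactly when \<open>N\<close> or \<open>T\<close> is not contained in \<open>P\<close>
  (\<open>set_add_meets_complement_iff\<close>). If \<open>N\<close> is not contained in \<open>P\<close>, the conclusion in the
  definition of m-closedness is therefore automatic, and for \<open>N \<subseteq> P\<close> the definition is the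
  contrapositive of the following: for proper ideals \<open>I, J, K\<close> and every submodule \<open>L\<close>,
  \<open>IJKL \<subseteq> P\<close> implies \<open>IJL \<subseteq> P\<close> or \<open>KL \<subseteq> P\<close>
  (\<open>complement_m_closed_iff_ideal_smult\<close>). It remains to pass between this ideal version and the
  elementwise definition of a classical 1-absorbing prime submodule.

  From elements to ideals (\<open>classical_1_absorbing_prime_ideal_smultD\<close>): proper ideals consist of
  nonunits. For a single \<open>x \<in> L\<close>, if some \<open>c \<in> K\<close> has \<open>cx \<notin> P\<close>, then \<open>abx \<in> P\<close> for all
  \<open>a \<in> I\<close> and \<open>b \<in> J\<close>; so \<open>x\<close> lies in \<open>(P : IJ)\<close> or in \<open>(P : K)\<close>. Both residuals are submodules, and
  a submodule covered by two submodules lies in one of them; hence the choice can be made uniformly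
  over \<open>L\<close>.

  From ideals to elements (\<open>classical_1_absorbing_primeI_ideal_smult\<close>): if \<open>abcm \<in> P\<close>, take the
  principal ideals of \<open>a\<close>, \<open>b\<close>, \<open>c\<close>, which are proper, and for \<open>L\<close> the residual \<open>(P : abc)\<close>. This
  is the largest submodule with \<open>abcL \<subseteq> P\<close>, and it contains \<open>m\<close>.
\<close>

section \<open>Proper ideals and nonunits\<close>

lemma proper_ideal_subset_nonunits:
  assumes "proper_ideal I R"
  shows "I \<subseteq> nonunits R"
proof -
  interpret ideal I R
    using assms by (simp add: proper_ideal_def)
  show ?thesis
  proof
    fix a assume a: "a \<in> I"
    have "a \<notin> Units R"
    proof
      assume "a \<in> Units R"
      then have "\<one>\<^bsub>R\<^esub> \<in> I"
        by (metis a I_l_closed Units_inv_closed Units_l_inv)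
      then show False
        using one_imp_carrier assms by (simp add: proper_ideal_def)
    qed
    then show "a \<in> nonunits R"
      using a a_subset by (auto simp: nonunits_def)
  qed
qed

lemma (in cring) proper_ideal_cgenideal:
  assumes "a \<in> nonunits R"
  shows "proper_ideal (PIdl a) R"
proof -
  have a: "a \<in> carrier R" "a \<notin> Units R"
    using assms by (auto simp: nonunits_def)
  have "\<one> \<notin> PIdl a"
  proof
    assume "\<one> \<in> PIdl a"
    then obtain x where "x \<in> carrier R" "\<one> = x \<otimes> a"
      by (auto simp: cgenideal_def)
    then have "a \<in> Units R"
      using a(1) by (auto simp: Units_def m_comm intro!: bexI[of _ x])
    then show False using a(2) by simp
  qed
  then show ?thesis
    using cgenideal_ideal[OF a(1)] by (auto simp: proper_ideal_def)
qed

context module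
begin

section \<open>Residuals and unions of submodules\<close>

lemma submodule_zero_closed:
  assumes "submodule P R M"
  shows "\<zero>\<^bsub>M\<^esub> \<in> P"
  using subgroup.one_closed[OF submodule.axioms(1)[OF assms]] by simp

text \<open>This is the residual \<open>(P :\<^sub>M T)\<close>; commutativity of the ring makes it closed under scalars.\<close>

lemma submodule_residual:
  assumes P: "submodule P R M" and T: "T \<subseteq> carrier R"
  shows "submodule {x \<in> carrier M. \<forall>r\<in>T. r \<odot>\<^bsub>M\<^esub> x \<in> P} R M"
proof (rule submoduleI)
  fix a x
  assume a: "a \<in> carrier R" and x: "x \<in> {x \<in> carrier M. \<forall>r\<in>T. r \<odot>\<^bsub>M\<^esub> x \<in> P}"
  have "r \<odot>\<^bsub>M\<^esub> (a \<odot>\<^bsub>M\<^esub> x) \<in> P" if r: "r \<in> T" for r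
  proof -
    have "r \<odot>\<^bsub>M\<^esub> (a \<odot>\<^bsub>M\<^esub> x) = a \<odot>\<^bsub>M\<^esub> (r \<odot>\<^bsub>M\<^esub> x)"
      using a x r T by (metis (no_types, lifting) mem_Collect_eq R.m_comm smult_assoc1 subsetD)
    then show ?thesis
      using submoduleE(4)[OF P a] x r by simp
  qed
  then show "a \<odot>\<^bsub>M\<^esub> x \<in> {x \<in> carrier M. \<forall>r\<in>T. r \<odot>\<^bsub>M\<^esub> x \<in> P}"
    using a x by simp
qed (use T submodule_zero_closed[OF P] submoduleE(3,5)[OF P]
      in \<open>auto simp: smult_r_distr smult_r_minus subset_iff\<close>)

text \<open>This is the residual \<open>(P :\<^sub>R Y)\<close>. That it is closed under addition lets inclusions of
  product ideals in it be tested on products of elements.\<close>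

lemma ideal_residual:
  assumes P: "submodule P R M" and Y: "Y \<subseteq> carrier M"
  shows "ideal {r \<in> carrier R. \<forall>x\<in>Y. r \<odot>\<^bsub>M\<^esub> x \<in> P} R" (is "ideal ?Q R")
proof (rule idealI)
  show "ring R" by (rule R.ring_axioms)
  show "subgroup ?Q (add_monoid R)"
  proof (rule group.subgroupI[OF R.add.is_group])
    have "\<zero> \<in> ?Q"
      using Y submodule_zero_closed[OF P] by (auto simp: subset_iff)
    then show "?Q \<noteq> {}" by blast
  next
    fix r assume "r \<in> ?Q"
    then have "\<ominus> r \<in> ?Q"
      using Y submoduleE(3)[OF P] by (auto simp: smult_l_minus subset_iff)
    then show "inv\<^bsub>add_monoid R\<^esub> r \<in> ?Q" by (simp add: a_inv_def)
  qed (use Y submoduleE(5)[OF P] in \<open>auto simp: smult_l_distr subset_iff\<close>)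
next
  fix r s assume r: "r \<in> ?Q" and s: "s \<in> carrier R"
  then show "s \<otimes> r \<in> ?Q"
    using Y submoduleE(4)[OF P s] by (auto simp: smult_assoc1 subset_iff)
  then show "r \<otimes> s \<in> ?Q"
    using r s by (simp add: R.m_comm)
qed

text \<open>If \<open>x\<close> witnesses that \<open>L\<close> is not contained in \<open>P\<close> and \<open>y\<close> that it is not contained in
  \<open>Q\<close>, then \<open>x \<in> Q\<close> and \<open>y \<in> P\<close>, and \<open>x + y\<close> lies in neither.\<close>

lemma submodule_subset_Un:
  assumes L: "submodule L R M" and P: "submodule P R M" and Q: "submodule Q R M"
    and sub: "L \<subseteq> P \<union> Q"
  shows "L \<subseteq> P \<or> L \<subseteq> Q"
proof (rule ccontr)
  assume "\<not> (L \<subseteq> P \<or> L \<subseteq> Q)"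
  then obtain x y where x: "x \<in> L" "x \<notin> P" and y: "y \<in> L" "y \<notin> Q" by blast
  have car: "x \<in> carrier M" "y \<in> carrier M"
    using x y submoduleE(1)[OF L] by auto
  have "x \<oplus>\<^bsub>M\<^esub> y \<in> P \<union> Q"
    using submoduleE(5)[OF L x(1) y(1)] sub by blast
  then show False
  proof
    assume "x \<oplus>\<^bsub>M\<^esub> y \<in> P"
    moreover have "y \<in> P" using y sub by blast
    ultimately have "(x \<oplus>\<^bsub>M\<^esub> y) \<oplus>\<^bsub>M\<^esub> \<ominus>\<^bsub>M\<^esub> y \<in> P"
      using submoduleE(3,5)[OF P] by blast
    then show False using x(2) car by (simp add: M.a_assoc M.r_neg)
  next
    assume "x \<oplus>\<^bsub>M\<^esub> y \<in> Q"
    moreover have "x \<in> Q" using x sub by blast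
    ultimately have "\<ominus>\<^bsub>M\<^esub> x \<oplus>\<^bsub>M\<^esub> (x \<oplus>\<^bsub>M\<^esub> y) \<in> Q"
      using submoduleE(3,5)[OF Q] by blast
    then show False using y(2) car by (simp add: M.r_neg1)
  qed
qed

lemma set_add_meets_complement_iff:
  assumes N: "submodule N R M" and P: "submodule P R M"
    and T: "T \<subseteq> carrier M" "\<zero>\<^bsub>M\<^esub> \<in> T"
  shows "(N <+>\<^bsub>M\<^esub> T) \<inter> (carrier M - P) \<noteq> {} \<longleftrightarrow> \<not> (N \<subseteq> P \<and> T \<subseteq> P)"
proof -
  have N': "N \<subseteq> carrier M" "\<zero>\<^bsub>M\<^esub> \<in> N"
    using submoduleE(1)[OF N] submodule_zero_closed[OF N] by auto
  have car: "N <+>\<^bsub>M\<^esub> T \<subseteq> carrier M"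
    using N' T by (auto simp: set_add_def')
  have sum: "n \<oplus>\<^bsub>M\<^esub> t \<in> N <+>\<^bsub>M\<^esub> T" if "n \<in> N" "t \<in> T" for n t
    using that by (auto simp: set_add_def')
  have N_sub: "N \<subseteq> N <+>\<^bsub>M\<^esub> T"
  proof
    fix n assume n: "n \<in> N"
    then have "n \<in> carrier M" using N'(1) by blast
    then show "n \<in> N <+>\<^bsub>M\<^esub> T" using sum[OF n T(2)] by simp
  qed
  have T_sub: "T \<subseteq> N <+>\<^bsub>M\<^esub> T"
  proof
    fix t assume t: "t \<in> T"
    then have "t \<in> carrier M" using T(1) by blast
    then show "t \<in> N <+>\<^bsub>M\<^esub> T" using sum[OF N'(2) t] by simp
  qed
  have "N <+>\<^bsub>M\<^esub> T \<subseteq> P \<longleftrightarrow> N \<subseteq> P \<and> T \<subseteq> P"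
  proof
    assume "N \<subseteq> P \<and> T \<subseteq> P"
    then show "N <+>\<^bsub>M\<^esub> T \<subseteq> P"
      using submoduleE(5)[OF P] by (auto simp: set_add_def')
  qed (use N_sub T_sub in blast)
  then show ?thesis using car by blast
qed

section \<open>Products of ideals and submodules\<close>

lemma ideal_smult_subset_iff:
  assumes "submodule P R M"
  shows "ideal_smult M I L \<subseteq> P \<longleftrightarrow> (\<forall>r\<in>I. \<forall>x\<in>L. r \<odot>\<^bsub>M\<^esub> x \<in> P)"
proof
  assume "ideal_smult M I L \<subseteq> P"
  then show "\<forall>r\<in>I. \<forall>x\<in>L. r \<odot>\<^bsub>M\<^esub> x \<in> P"
    by (auto intro: ideal_smult.prod)
next
  assume gen: "\<forall>r\<in>I. \<forall>x\<in>L. r \<odot>\<^bsub>M\<^esub> x \<in> P"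
  show "ideal_smult M I L \<subseteq> P"
  proof
    fix z assume "z \<in> ideal_smult M I L"
    then show "z \<in> P"
      by induction (use gen submoduleE(5)[OF assms] in auto)
  qed
qed

lemma ideal_smult_subset_carrier:
  assumes "ideal I R" "submodule L R M"
  shows "ideal_smult M I L \<subseteq> carrier M"
  using ideal.Icarr[OF assms(1)] submoduleE(1)[OF assms(2)]
  by (auto simp: ideal_smult_subset_iff[OF carrier_is_submodule])

lemma zero_in_ideal_smult:
  assumes "ideal I R" "submodule L R M"
  shows "\<zero>\<^bsub>M\<^esub> \<in> ideal_smult M I L"
  using ideal_smult.prod[of \<zero> I "\<zero>\<^bsub>M\<^esub>" L M] submodule_zero_closed[OF assms(2)]
    additive_subgroup.zero_closed[OF ideal.axioms(1)[OF assms(1)]]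
  by simp

text \<open>Since the scalars carrying \<open>Y\<close> into \<open>P\<close> form an ideal, it suffices to test the generators
  of the product ideal.\<close>

lemma ideal_prod_smult_closed_iff:
  assumes P: "submodule P R M" and Y: "Y \<subseteq> carrier M"
    and I: "I \<subseteq> carrier R" and J: "J \<subseteq> carrier R"
  shows "(\<forall>s\<in>I \<cdot> J. \<forall>x\<in>Y. s \<odot>\<^bsub>M\<^esub> x \<in> P) \<longleftrightarrow> (\<forall>a\<in>I. \<forall>b\<in>J. \<forall>x\<in>Y. (a \<otimes> b) \<odot>\<^bsub>M\<^esub> x \<in> P)"
proof
  assume "\<forall>s\<in>I \<cdot> J. \<forall>x\<in>Y. s \<odot>\<^bsub>M\<^esub> x \<in> P"
  then show "\<forall>a\<in>I. \<forall>b\<in>J. \<forall>x\<in>Y. (a \<otimes> b) \<odot>\<^bsub>M\<^esub> x \<in> P"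
    by (auto intro: ideal_prod.prod)
next
  assume gen: "\<forall>a\<in>I. \<forall>b\<in>J. \<forall>x\<in>Y. (a \<otimes> b) \<odot>\<^bsub>M\<^esub> x \<in> P"
  let ?Q = "{r \<in> carrier R. \<forall>x\<in>Y. r \<odot>\<^bsub>M\<^esub> x \<in> P}"
  have "s \<in> ?Q" if "s \<in> I \<cdot> J" for s
    using that
  proof induction
    case (prod i j)
    then show ?case using gen I J by auto
  next
    case (sum s t)
    then show ?case
      using additive_subgroup.a_closed[OF ideal.axioms(1)[OF ideal_residual[OF P Y]]] by blast
  qed
  then show "\<forall>s\<in>I \<cdot> J. \<forall>x\<in>Y. s \<odot>\<^bsub>M\<^esub> x \<in> P" by blast
qed

lemma ideal_prod_smult_subset_iff:
  assumes P: "submodule P R M" and L: "submodule L R M" and I: "ideal I R" and J: "ideal J R"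
  shows "ideal_smult M (I \<cdot> J) L \<subseteq> P \<longleftrightarrow> (\<forall>a\<in>I. \<forall>b\<in>J. \<forall>x\<in>L. (a \<otimes> b) \<odot>\<^bsub>M\<^esub> x \<in> P)"
  unfolding ideal_smult_subset_iff[OF P]
  by (rule ideal_prod_smult_closed_iff[OF P submoduleE(1)[OF L]])
    (use I J in \<open>auto intro: ideal.Icarr\<close>)

text \<open>With \<open>Y\<close> the set of products \<open>cx\<close>, the case of three ideals reduces to that of two.\<close>

lemma ideal_prod3_smult_subset_iff:
  assumes P: "submodule P R M" and L: "submodule L R M"
    and I: "ideal I R" and J: "ideal J R" and K: "ideal K R"
  shows "ideal_smult M (I \<cdot> J \<cdot> K) L \<subseteq> P \<longleftrightarrow>
    (\<forall>a\<in>I. \<forall>b\<in>J. \<forall>c\<in>K. \<forall>x\<in>L. (a \<otimes> b \<otimes> c) \<odot>\<^bsub>M\<^esub> x \<in> P)"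
proof -
  let ?Y = "{c \<odot>\<^bsub>M\<^esub> x | c x. c \<in> K \<and> x \<in> L}"
  have car: "\<And>a. a \<in> I \<Longrightarrow> a \<in> carrier R" "\<And>b. b \<in> J \<Longrightarrow> b \<in> carrier R"
    "\<And>c. c \<in> K \<Longrightarrow> c \<in> carrier R" "\<And>x. x \<in> L \<Longrightarrow> x \<in> carrier M"
    "\<And>s. s \<in> I \<cdot> J \<Longrightarrow> s \<in> carrier R"
    using I J K submoduleE(1)[OF L] R.ideal_prod_in_carrier[OF I J] by (auto intro: ideal.Icarr)
  have assoc: "(s \<otimes> c) \<odot>\<^bsub>M\<^esub> x = s \<odot>\<^bsub>M\<^esub> (c \<odot>\<^bsub>M\<^esub> x)"
    if "s \<in> carrier R" "c \<in> K" "x \<in> L" for s c x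
    using that car by (intro smult_assoc1) auto
  have "ideal_smult M (I \<cdot> J \<cdot> K) L \<subseteq> P \<longleftrightarrow>
      (\<forall>s\<in>I \<cdot> J. \<forall>c\<in>K. \<forall>x\<in>L. (s \<otimes> c) \<odot>\<^bsub>M\<^esub> x \<in> P)"
    by (rule ideal_prod_smult_subset_iff[OF P L R.ideal_prod_is_ideal[OF I J] K])
  also have "\<dots> \<longleftrightarrow> (\<forall>s\<in>I \<cdot> J. \<forall>y\<in>?Y. s \<odot>\<^bsub>M\<^esub> y \<in> P)"
    using assoc car(5) by fastforce
  also have "\<dots> \<longleftrightarrow> (\<forall>a\<in>I. \<forall>b\<in>J. \<forall>y\<in>?Y. (a \<otimes> b) \<odot>\<^bsub>M\<^esub> y \<in> P)"
    by (rule ideal_prod_smult_closed_iff[OF P]) (use car in auto)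
  also have "\<dots> \<longleftrightarrow> (\<forall>a\<in>I. \<forall>b\<in>J. \<forall>c\<in>K. \<forall>x\<in>L. (a \<otimes> b \<otimes> c) \<odot>\<^bsub>M\<^esub> x \<in> P)"
    using assoc car(1,2) by fastforce
  finally show ?thesis .
qed

section \<open>The ideal version of classical 1-absorbing primeness\<close>

text \<open>Each \<open>x \<in> L\<close> separately satisfies \<open>IJx \<subseteq> P\<close> or \<open>Kx \<subseteq> P\<close>, so \<open>L\<close> is covered by the
  submodules \<open>(P : IJ)\<close> and \<open>(P : K)\<close>.\<close>

lemma classical_1_absorbing_prime_ideal_smultD:
  assumes prime: "classical_1_absorbing_prime P R M"
    and I: "proper_ideal I R" and J: "proper_ideal J R" and K: "proper_ideal K R"
    and L: "submodule L R M"
    and sub: "ideal_smult M (I \<cdot> J \<cdot> K) L \<subseteq> P"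
  shows "ideal_smult M (I \<cdot> J) L \<subseteq> P \<or> ideal_smult M K L \<subseteq> P"
proof -
  have P: "submodule P R M"
    using prime by (simp add: classical_1_absorbing_prime_def proper_submodule_def)
  have ideals: "ideal I R" "ideal J R" "ideal K R"
    using I J K by (auto simp: proper_ideal_def)
  let ?T = "{a \<otimes> b | a b. a \<in> I \<and> b \<in> J}"
  let ?U = "{x \<in> carrier M. \<forall>r\<in>?T. r \<odot>\<^bsub>M\<^esub> x \<in> P}"
  let ?V = "{x \<in> carrier M. \<forall>r\<in>K. r \<odot>\<^bsub>M\<^esub> x \<in> P}"
  have U: "submodule ?U R M"
    by (rule submodule_residual[OF P]) (use ideals in \<open>auto intro: ideal.Icarr\<close>)
  have V: "submodule ?V R M"
    by (rule submodule_residual[OF P]) (use ideals in \<open>auto intro: ideal.Icarr\<close>)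
  have "L \<subseteq> ?U \<union> ?V"
  proof
    fix x assume x: "x \<in> L"
    have xM: "x \<in> carrier M" using x submoduleE(1)[OF L] by blast
    have "(a \<otimes> b) \<odot>\<^bsub>M\<^esub> x \<in> P \<or> c \<odot>\<^bsub>M\<^esub> x \<in> P" if "a \<in> I" "b \<in> J" "c \<in> K" for a b c
    proof -
      have "a \<in> nonunits R" "b \<in> nonunits R" "c \<in> nonunits R"
        using that I J K proper_ideal_subset_nonunits by blast+
      moreover have "(a \<otimes> b \<otimes> c) \<odot>\<^bsub>M\<^esub> x \<in> P"
        using sub that x unfolding ideal_prod3_smult_subset_iff[OF P L ideals] by blast
      ultimately show ?thesis
        using prime xM unfolding classical_1_absorbing_prime_def by blast
    qed
    then show "x \<in> ?U \<union> ?V" using xM by blast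
  qed
  from submodule_subset_Un[OF L U V this] show ?thesis
  proof
    assume "L \<subseteq> ?U"
    then show ?thesis
      unfolding ideal_prod_smult_subset_iff[OF P L ideals(1,2)] by blast
  next
    assume "L \<subseteq> ?V"
    then show ?thesis
      unfolding ideal_smult_subset_iff[OF P] by blast
  qed
qed

text \<open>The ideal condition is used for the principal ideals of \<open>a\<close>, \<open>b\<close>, \<open>c\<close> and \<open>L = (P : abc)\<close>, a
  submodule that contains \<open>m\<close> and satisfies \<open>abcL \<subseteq> P\<close> by construction.\<close>

lemma classical_1_absorbing_primeI_ideal_smult:
  assumes P: "proper_submodule P R M"
    and absorb: "\<And>I J K L. \<lbrakk>proper_ideal I R; proper_ideal J R; proper_ideal K R; submodule L R M;
      ideal_smult M (I \<cdot> J \<cdot> K) L \<subseteq> P\<rbrakk> \<Longrightarrow> ideal_smult M (I \<cdot> J) L \<subseteq> P \<or> ideal_smult M K L \<subseteq> P"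
  shows "classical_1_absorbing_prime P R M"
  unfolding classical_1_absorbing_prime_def
proof (intro conjI ballI impI)
  show "proper_submodule P R M" by (rule P)
next
  fix a b c m
  assume nu: "a \<in> nonunits R" "b \<in> nonunits R" "c \<in> nonunits R"
    and m: "m \<in> carrier M" and abcm: "(a \<otimes> b \<otimes> c) \<odot>\<^bsub>M\<^esub> m \<in> P"
  have P': "submodule P R M" using P by (simp add: proper_submodule_def)
  have car: "a \<in> carrier R" "b \<in> carrier R" "c \<in> carrier R"
    using nu by (auto simp: nonunits_def)
  let ?L = "{x \<in> carrier M. \<forall>r\<in>{a \<otimes> b \<otimes> c}. r \<odot>\<^bsub>M\<^esub> x \<in> P}"
  have L: "submodule ?L R M"
    by (rule submodule_residual[OF P']) (use car in auto)
  have mL: "m \<in> ?L" using m abcm by simp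
  note ideals = car[THEN R.cgenideal_ideal]
  have "ideal_smult M ((PIdl a) \<cdot> (PIdl b) \<cdot> (PIdl c)) ?L \<subseteq> P"
    unfolding ideal_prod3_smult_subset_iff[OF P' L ideals]
  proof (intro ballI)
    fix i j k x assume "i \<in> PIdl a" "j \<in> PIdl b" "k \<in> PIdl c" and x: "x \<in> ?L"
    then obtain u v w where uvw: "u \<in> carrier R" "v \<in> carrier R" "w \<in> carrier R"
      and ijk: "i = u \<otimes> a" "j = v \<otimes> b" "k = w \<otimes> c"
      by (auto simp: cgenideal_def)
    have "i \<otimes> j \<otimes> k = (u \<otimes> v \<otimes> w) \<otimes> (a \<otimes> b \<otimes> c)"
      unfolding ijk using uvw car by (simp add: R.m_ac)
    then have "(i \<otimes> j \<otimes> k) \<odot>\<^bsub>M\<^esub> x = (u \<otimes> v \<otimes> w) \<odot>\<^bsub>M\<^esub> ((a \<otimes> b \<otimes> c) \<odot>\<^bsub>M\<^esub> x)"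
      using uvw car x by (simp add: smult_assoc1)
    then show "(i \<otimes> j \<otimes> k) \<odot>\<^bsub>M\<^esub> x \<in> P"
      using submoduleE(4)[OF P', of "u \<otimes> v \<otimes> w"] uvw x by simp
  qed
  from absorb[OF nu[THEN R.proper_ideal_cgenideal] L this]
  show "(a \<otimes> b) \<odot>\<^bsub>M\<^esub> m \<in> P \<or> c \<odot>\<^bsub>M\<^esub> m \<in> P"
  proof
    assume "ideal_smult M ((PIdl a) \<cdot> (PIdl b)) ?L \<subseteq> P"
    moreover have "(a \<otimes> b) \<odot>\<^bsub>M\<^esub> m \<in> ideal_smult M ((PIdl a) \<cdot> (PIdl b)) ?L"
      by (intro ideal_smult.prod ideal_prod.prod mL car[THEN R.cgenideal_self])
    ultimately show ?thesis by (rule disjI1[OF subsetD])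
  next
    assume "ideal_smult M (PIdl c) ?L \<subseteq> P"
    moreover have "c \<odot>\<^bsub>M\<^esub> m \<in> ideal_smult M (PIdl c) ?L"
      by (intro ideal_smult.prod mL car[THEN R.cgenideal_self])
    ultimately show ?thesis by (rule disjI2[OF subsetD])
  qed
qed

section \<open>Complements of submodules as m-closed sets\<close>

text \<open>An \<open>N\<close> not contained in \<open>P\<close> makes all three intersections nonempty, while every \<open>N \<subseteq> P\<close>
  gives the same condition; the choice \<open>N = P\<close> extracts it.\<close>

lemma complement_m_closed_iff_ideal_smult:
  assumes P: "submodule P R M"
  shows "classical_1_absorbing_prime_m_closed (carrier M - P) R M \<longleftrightarrow>
    (\<forall>I J K L. proper_ideal I R \<and> proper_ideal J R \<and> proper_ideal K R \<and> submodule L R M \<longrightarrow>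
      ideal_smult M (I \<cdot> J \<cdot> K) L \<subseteq> P \<longrightarrow>
      ideal_smult M (I \<cdot> J) L \<subseteq> P \<or> ideal_smult M K L \<subseteq> P)"
    (is "_ \<longleftrightarrow> ?absorb")
proof -
  have meets: "(N <+>\<^bsub>M\<^esub> ideal_smult M I L) \<inter> (carrier M - P) \<noteq> {} \<longleftrightarrow>
      \<not> (N \<subseteq> P \<and> ideal_smult M I L \<subseteq> P)"
    if "ideal I R" "submodule L R M" "submodule N R M" for I L N
    using that
    by (intro set_add_meets_complement_iff P ideal_smult_subset_carrier zero_in_ideal_smult)
  have idealD: "ideal I R" if "proper_ideal I R" for I
    using that by (simp add: proper_ideal_def)
  show ?thesis
  proof
    assume closed: "classical_1_absorbing_prime_m_closed (carrier M - P) R M"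
    show ?absorb
    proof (intro allI impI)
      fix I J K L
      assume IJKL: "proper_ideal I R \<and> proper_ideal J R \<and> proper_ideal K R \<and> submodule L R M"
        and sub: "ideal_smult M (I \<cdot> J \<cdot> K) L \<subseteq> P"
      have ideals: "ideal I R" "ideal J R" "ideal K R" and L: "submodule L R M"
        using IJKL idealD by auto
      note IJ = R.ideal_prod_is_ideal[OF ideals(1,2)]
      note IJK = R.ideal_prod_is_ideal[OF IJ ideals(3)]
      have "(P <+>\<^bsub>M\<^esub> ideal_smult M (I \<cdot> J) L) \<inter> (carrier M - P) \<noteq> {} \<longrightarrow>
          (P <+>\<^bsub>M\<^esub> ideal_smult M K L) \<inter> (carrier M - P) \<noteq> {} \<longrightarrow>
          (P <+>\<^bsub>M\<^esub> ideal_smult M (I \<cdot> J \<cdot> K) L) \<inter> (carrier M - P) \<noteq> {}"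
        using closed[unfolded classical_1_absorbing_prime_m_closed_def, THEN conjunct2,
            THEN spec[of _ I], THEN spec[of _ J], THEN spec[of _ K], THEN spec[of _ L],
            THEN spec[of _ P]] IJKL P
        by argo
      then show "ideal_smult M (I \<cdot> J) L \<subseteq> P \<or> ideal_smult M K L \<subseteq> P"
        unfolding meets[OF IJ L P] meets[OF ideals(3) L P] meets[OF IJK L P] using sub by blast
    qed
  next
    assume absorb: ?absorb
    show "classical_1_absorbing_prime_m_closed (carrier M - P) R M"
      unfolding classical_1_absorbing_prime_m_closed_def
    proof (intro conjI allI impI)
      show "carrier M - P \<subseteq> carrier M - {\<zero>\<^bsub>M\<^esub>}"
        using submodule_zero_closed[OF P] by blast
    next
      fix I J K L N
      assume hyp: "proper_ideal I R \<and> proper_ideal J R \<and> proper_ideal K R \<and>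
          submodule L R M \<and> submodule N R M"
        and IJL: "(N <+>\<^bsub>M\<^esub> ideal_smult M (I \<cdot> J) L) \<inter> (carrier M - P) \<noteq> {}"
        and KL: "(N <+>\<^bsub>M\<^esub> ideal_smult M K L) \<inter> (carrier M - P) \<noteq> {}"
      have ideals: "ideal I R" "ideal J R" "ideal K R"
        and L: "submodule L R M" and N: "submodule N R M"
        using hyp idealD by auto
      note IJ = R.ideal_prod_is_ideal[OF ideals(1,2)]
      note IJK = R.ideal_prod_is_ideal[OF IJ ideals(3)]
      show "(N <+>\<^bsub>M\<^esub> ideal_smult M (I \<cdot> J \<cdot> K) L) \<inter> (carrier M - P) \<noteq> {}"
        using IJL KL absorb hyp
        unfolding meets[OF IJ L N] meets[OF ideals(3) L N] meets[OF IJK L N] by blast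
    qed
  qed
qed

end

theorem proposition7:
  fixes A :: "('r, 'b) ring_scheme"
    and M :: "('r, 'm, 'c) module_scheme"
    and P :: "'m set"
  assumes "module A M"
    and "\<one>\<^bsub>A\<^esub> \<noteq> \<zero>\<^bsub>A\<^esub>"
    and "carrier M \<noteq> {\<zero>\<^bsub>M\<^esub>}"
    and "proper_submodule P A M"
  shows "classical_1_absorbing_prime P A M \<longleftrightarrow>
         classical_1_absorbing_prime_m_closed (carrier M - P) A M"
proof -
  interpret module A M by (rule assms(1))
  have P: "submodule P A M"
    using assms(4) by (simp add: proper_submodule_def)
  show ?thesis
    unfolding complement_m_closed_iff_ideal_smult[OF P]
  proof (intro iffI allI impI)
    fix I J K L
    assume "classical_1_absorbing_prime P A M"
      and "proper_ideal I A \<and> proper_ideal J A \<and> proper_ideal K A \<and> submodule L A M"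
      and "ideal_smult M (I \<cdot>\<^bsub>A\<^esub> J \<cdot>\<^bsub>A\<^esub> K) L \<subseteq> P"
    then show "ideal_smult M (I \<cdot>\<^bsub>A\<^esub> J) L \<subseteq> P \<or> ideal_smult M K L \<subseteq> P"
      by (intro classical_1_absorbing_prime_ideal_smultD) auto
  next
    assume "\<forall>I J K L.
        proper_ideal I A \<and> proper_ideal J A \<and> proper_ideal K A \<and> submodule L A M \<longrightarrow>
        ideal_smult M (I \<cdot>\<^bsub>A\<^esub> J \<cdot>\<^bsub>A\<^esub> K) L \<subseteq> P \<longrightarrow>
        ideal_smult M (I \<cdot>\<^bsub>A\<^esub> J) L \<subseteq> P \<or> ideal_smult M K L \<subseteq> P"
    then show "classical_1_absorbing_prime P A M"
      by (intro classical_1_absorbing_primeI_ideal_smult[OF assms(4)]) simp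
  qed
qed

end
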